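(* For $n\ge 0$ and $d\ge 1$, we have 1. $\operatorname{maxroot}\big(C_d^{(n+1)}\big)\le \gamma_{n/d}$; 2. for all $x>\gamma_{n/d}$, $$\mathcal{G}_{C_d^{(n+1)}}(x)\le \frac{-nx+\sqrt{(n+d)^2(x^2-1)+n^2}}{d(x^2-1)},$$ where $\gamma_{n/d}=\sqrt{1-\frac{n^2}{(n+d)^2}}$.
   Context: Here $n$ and $d$ are integers. For real $a>0$, the Gegenbauer polynomials $C_m^{(a)}(x)$ are defined by $\sum_{m\ge 0}C_m^{(a)}(x)t^m=(1-2xt+t^2)^{-a}$. For a nonconstant polynomial $p$, its Cauchy transform is $\mathcal{G}_p(x)=\frac{1}{\deg p}\,\frac{p'(x)}{p(x)}$, and $\operatorname{maxroot}(p)$ is its largest real root. The apparent singularity of the bound in part 2 at $x=1$ is removable: the right-hand side can equivalently be written as $\frac{2n+d}{nx+\sqrt{(n+d)^2(x^2-1)+n^2}}$. *)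

theory Defs
  imports "HOL-Complex_Analysis.Complex_Analysis" "HOL-Computational_Algebra.Computational_Algebra"
begin

(* The generating function (1 - 2xt + t^2)^(-a) is read as a formal power series in t whose
   coefficients are polynomials in x: the binomial series of (1 + u)^(-a), with u = t^2 - 2xt
   substituted for u.  The lemma gegenbauer_sums below recovers the analytic identity. *)
definition gegenbauer :: "real \<Rightarrow> nat \<Rightarrow> real poly" where
  "gegenbauer a m =
     fps_nth (Abs_fps (\<lambda>k. [:(- a) gchoose k:]) oo (fps_X\<^sup>2 - fps_const [:0, 2:] * fps_X)) m"

definition cauchy_transform :: "real poly \<Rightarrow> real \<Rightarrow> real" where
  "cauchy_transform p x = 1 / real (degree p) * (poly (pderiv p) x / poly p x)"

(* The largest real root, for p with at least one and only finitely many real roots;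
   otherwise Max is unspecified. *)
definition maxroot :: "real poly \<Rightarrow> real" where
  "maxroot p = Max {x. poly p x = 0}"

definition gamma_nd :: "nat \<Rightarrow> nat \<Rightarrow> real" where
  "gamma_nd n d = sqrt (1 - (real n)\<^sup>2 / (real (n + d))\<^sup>2)"

(* For x = 1 the quotient is 0/0; the removable singularity is filled with the limit
   (see cauchy_bound_eq and isCont_cauchy_bound_1 below).  The point x = 1 exceeds
   gamma_nd n d exactly when n > 0, so the value at x = 1 only matters for n > 0. *)
definition cauchy_bound :: "nat \<Rightarrow> nat \<Rightarrow> real \<Rightarrow> real" where
  "cauchy_bound n d x =
     (if x = 1 then (2 * real n + real d) / (2 * real n)
      else (- real n * x + sqrt ((real n + real d)\<^sup>2 * (x\<^sup>2 - 1) + (real n)\<^sup>2))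
             / (real d * (x\<^sup>2 - 1)))"

lemma poly_fps_power_nth:
  fixes F :: "'a::comm_ring_1 poly fps"
  shows "poly (fps_nth (F ^ k) n) x = fps_nth (Abs_fps (\<lambda>i. poly (fps_nth F i) x) ^ k) n"
proof (induction k arbitrary: n)
  case 0
  then show ?case by (cases n) auto
next
  case (Suc k)
  then show ?case by (simp add: fps_mult_nth poly_sum)
qed

lemma poly_gegenbauer:
  "poly (gegenbauer a m) x =
     fps_nth (fps_binomial (- a) oo (fps_X\<^sup>2 - fps_const (2 * x) * fps_X)) m"
proof -
  have "Abs_fps (\<lambda>i. poly (fps_nth (fps_X\<^sup>2 - fps_const [:0, 2:] * fps_X) i) x)
      = fps_X\<^sup>2 - fps_const (2 * x) * fps_X"
    by (rule fps_ext) (auto simp: fps_X_power_nth if_distrib)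
  then show ?thesis
    by (simp add: gegenbauer_def fps_compose_nth poly_sum poly_fps_power_nth)
qed

lemma gegenbauer_sums:
  "eventually (\<lambda>t. (\<lambda>m. poly (gegenbauer a m) x * t ^ m) sums
     ((1 - 2 * x * t + t\<^sup>2) powr (- a))) (nhds (0::real))"
proof -
  let ?u = "fps_X\<^sup>2 - fps_const (2 * x) * fps_X :: real fps"
  let ?uc = "fps_X\<^sup>2 - fps_const (2 * complex_of_real x) * fps_X :: complex fps"
  let ?F = "fps_binomial (- complex_of_real a) oo ?uc"
  have gch: "complex_of_real ((- a) gchoose k) = (- complex_of_real a) gchoose k" for k
    by (simp add: gbinomial_prod_rev)
  have u: "complex_of_real (fps_nth ?u n) = fps_nth ?uc n" for n
    by (auto simp: fps_X_power_nth)
  have pw: "complex_of_real (fps_nth (?u ^ k) n) = fps_nth (?uc ^ k) n" for k n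
  proof (induction k arbitrary: n)
    case 0
    then show ?case by (cases n) auto
  next
    case (Suc k)
    then show ?case by (simp only: power_Suc fps_mult_nth of_real_sum of_real_mult u)
  qed
  have coeff: "complex_of_real (poly (gegenbauer a m) x) = fps_nth ?F m" for m
    by (simp only: poly_gegenbauer fps_compose_nth of_real_sum of_real_mult gch pw fps_binomial_nth)
  have "(\<lambda>z. z\<^sup>2 - 2 * complex_of_real x * z) has_fps_expansion ?uc"
    by (intro fps_expansion_intros)
  then have "((\<lambda>z. (1 + z) powr (- complex_of_real a)) \<circ> (\<lambda>z. z\<^sup>2 - 2 * complex_of_real x * z))
      has_fps_expansion ?F"
    by (intro has_fps_expansion_compose fps_expansion_intros) auto
  then have rad: "fps_conv_radius ?F > 0"
    and ev: "eventually (\<lambda>z. eval_fps ?F z = (1 + (z\<^sup>2 - 2 * complex_of_real x * z)) powr (- complex_of_real a)) (nhds 0)"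
    by (auto simp: has_fps_expansion_def)
  have "eventually (\<lambda>z. z \<in> eball 0 (fps_conv_radius ?F)) (nhds (0::complex))"
    using rad by (intro eventually_nhds_in_open) (auto simp: zero_ereal_def)
  with ev have "eventually (\<lambda>z. (\<lambda>m. fps_nth ?F m * z ^ m) sums
      ((1 + (z\<^sup>2 - 2 * complex_of_real x * z)) powr (- complex_of_real a))) (nhds 0)"
  proof eventually_elim
    case (elim z)
    then show ?case using sums_eval_fps[of z ?F] by simp
  qed
  moreover have "filterlim complex_of_real (nhds 0) (nhds 0)"
    using tendsto_of_real[OF filterlim_ident[of "nhds (0::real)"]] by simp
  ultimately have "eventually (\<lambda>t. (\<lambda>m. fps_nth ?F m * complex_of_real t ^ m) sums
      ((1 + ((complex_of_real t)\<^sup>2 - 2 * complex_of_real x * complex_of_real t)) powr (- complex_of_real a))) (nhds 0)"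
    by (rule eventually_compose_filterlim)
  moreover have "eventually (\<lambda>t::real. 1 - 2 * x * t + t\<^sup>2 > 0) (nhds 0)"
  proof -
    have "((\<lambda>t::real. 1 - 2 * x * t + t\<^sup>2) \<longlongrightarrow> 1 - 2 * x * 0 + 0\<^sup>2) (nhds 0)"
      by (intro tendsto_intros filterlim_ident)
    then show ?thesis by (auto elim: order_tendstoD)
  qed
  ultimately show ?thesis
  proof eventually_elim
    case (elim t)
    have "(1 + ((complex_of_real t)\<^sup>2 - 2 * complex_of_real x * complex_of_real t)) powr (- complex_of_real a)
        = complex_of_real (1 - 2 * x * t + t\<^sup>2) powr complex_of_real (- a)"
      by (simp add: algebra_simps)
    also have "\<dots> = complex_of_real ((1 - 2 * x * t + t\<^sup>2) powr (- a))"
      using elim by (intro powr_of_real) auto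
    finally have "(\<lambda>m. complex_of_real (poly (gegenbauer a m) x * t ^ m)) sums
        complex_of_real ((1 - 2 * x * t + t\<^sup>2) powr (- a))"
      using elim by (simp add: coeff)
    then show ?case by (simp only: sums_of_real_iff)
  qed
qed

lemma cauchy_bound_eq:
  assumes d: "d \<ge> 1" and x: "x > gamma_nd n d"
  shows "cauchy_bound n d x =
    (2 * real n + real d) / (real n * x + sqrt ((real n + real d)\<^sup>2 * (x\<^sup>2 - 1) + (real n)\<^sup>2))"
proof -
  define N D where "N = real n" and "D = real d"
  have ND: "N \<ge> 0" "D > 0" using d by (auto simp: N_def D_def)
  define S where "S = (N + D)\<^sup>2 * (x\<^sup>2 - 1) + N\<^sup>2"
  have le1: "N\<^sup>2 / (N + D)\<^sup>2 \<le> 1"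
    using ND by (simp add: divide_le_eq_1 power_mono)
  have g: "gamma_nd n d = sqrt (1 - N\<^sup>2 / (N + D)\<^sup>2)"
    by (simp add: gamma_nd_def N_def D_def)
  have g0: "gamma_nd n d \<ge> 0" using le1 by (simp add: g)
  then have x0: "x > 0" using x by simp
  have "(gamma_nd n d)\<^sup>2 < x\<^sup>2" using x g0 by (intro power_strict_mono) auto
  then have "1 - N\<^sup>2 / (N + D)\<^sup>2 < x\<^sup>2" using le1 by (simp add: g)
  then have "(1 - N\<^sup>2 / (N + D)\<^sup>2) * (N + D)\<^sup>2 < x\<^sup>2 * (N + D)\<^sup>2"
    using ND by (intro mult_strict_right_mono) auto
  moreover have "(1 - N\<^sup>2 / (N + D)\<^sup>2) * (N + D)\<^sup>2 = (N + D)\<^sup>2 - N\<^sup>2"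
    using ND by (simp add: field_simps)
  ultimately have S: "S > 0" by (simp add: S_def algebra_simps)
  have den: "N * x + sqrt S > 0" using S ND x0 by (simp add: add_nonneg_pos)
  show ?thesis
  proof (cases "x = 1")
    case True
    then show ?thesis using ND by (simp add: cauchy_bound_def N_def D_def)
  next
    case False
    have x2: "x\<^sup>2 - 1 \<noteq> 0" using False x0 by (auto simp: power2_eq_1_iff)
    have "(- N * x + sqrt S) * (N * x + sqrt S) = S - N\<^sup>2 * x\<^sup>2"
      using S by (simp add: algebra_simps power2_eq_square)
    also have "\<dots> = (2 * N + D) * (D * (x\<^sup>2 - 1))"
      by (simp add: S_def algebra_simps power2_eq_square)
    finally have "(- N * x + sqrt S) / (D * (x\<^sup>2 - 1)) = (2 * N + D) / (N * x + sqrt S)"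
      using den x2 ND by (subst frac_eq_eq) auto
    then show ?thesis using False by (simp add: cauchy_bound_def N_def D_def S_def)
  qed
qed

lemma isCont_cauchy_bound_1:
  assumes "n > 0" "d \<ge> 1"
  shows "isCont (cauchy_bound n d) 1"
proof -
  have "(real n)\<^sup>2 / (real (n + d))\<^sup>2 > 0" using assms by simp
  then have "gamma_nd n d < 1" by (simp add: gamma_nd_def)
  then have ev: "eventually (\<lambda>x. x > gamma_nd n d) (nhds 1)"
    using eventually_nhds_in_open[of "{gamma_nd n d<..}" 1] by simp
  let ?f = "\<lambda>x. (2 * real n + real d) / (real n * x + sqrt ((real n + real d)\<^sup>2 * (x\<^sup>2 - 1) + (real n)\<^sup>2))"
  have "eventually (\<lambda>x. cauchy_bound n d x = ?f x) (nhds 1)"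
    using ev by eventually_elim (use assms cauchy_bound_eq in blast)
  moreover have "isCont ?f 1"
    using assms by (intro continuous_intros) auto
  ultimately show ?thesis using isCont_cong[of "cauchy_bound n d" ?f 1] by simp
qed

end

theory Submission
  imports Defs
begin

text \<open>
  Write \<open>p\<close> for the Gegenbauer polynomial, \<open>r\<close> for its roots and \<open>u = p' / p\<close>.  Up to a constant \<open>p\<close> is
  the \<open>n\<close>-th derivative of a Chebyshev polynomial of the second kind, so its roots are real, simple,
  contained in \<open>(-1, 1)\<close> and symmetric about \<open>0\<close>.  To the right of all roots the Gegenbauer
  differential equation becomes
  \<open>(x\<^sup>2 - 1) u\<^sup>2 + 2 n x u - d (2 n + d) = - (\<Sum>r. (1 + x r - 2 r\<^sup>2) / (x - r)\<^sup>2)\<close>,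
  and pairing \<open>r\<close> with \<open>- r\<close> shows that the right-hand side is nonpositive.  Multiplying by
  \<open>x\<^sup>2 - 1\<close> turns this into a comparison of \<open>((x\<^sup>2 - 1) u + n x)\<^sup>2\<close> with
  \<open>D = (n + d)\<^sup>2 (x\<^sup>2 - 1) + n\<^sup>2\<close>, which is positive for \<open>x\<close> beyond \<open>\<gamma>\<close>.  Hence
  \<open>(x\<^sup>2 - 1) p' + n x p\<close> has no zero in \<open>(max \<rho> \<gamma>, 1)\<close>, where \<open>\<rho>\<close> is the largest root.  It is
  positive at \<open>1\<close> and negative at \<open>\<rho>\<close>, which forces \<open>\<rho> \<le> \<gamma>\<close>; its positivity then selects the
  branch of the square root that gives the bound on \<open>u\<close>.
\<close>

section \<open>Differentiation in x: the parameter goes up by one and the degree goes down by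
  one\<close>

lemma pderiv_sum: "pderiv (\<Sum>i\<in>A. f i :: 'a :: idom poly) = (\<Sum>i\<in>A. pderiv (f i))"
  by (induction A rule: infinite_finite_induct) (auto simp: pderiv_add)

lemma smult_sum_right: "smult c (\<Sum>i\<in>A. f i) = (\<Sum>i\<in>A. smult c (f i))"
  by (induction A rule: infinite_finite_induct) (auto simp: smult_add_right)

text \<open>The derivative is taken in x, coefficient by coefficient of the series in t. It is a
  derivation of the ring of series, so the usual power rule follows.\<close>

lemma pderiv_fps_power:
  fixes F :: "real poly fps"
  shows "Abs_fps (\<lambda>i. pderiv (fps_nth (F ^ Suc k) i))
       = of_nat (Suc k) * F ^ k * Abs_fps (\<lambda>i. pderiv (fps_nth F i))"
proof -
  define D where "D = (\<lambda>F :: real poly fps. Abs_fps (\<lambda>i. pderiv (fps_nth F i)))"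
  have mult: "D (F * G) = F * D G + D F * G" for F G
    by (rule fps_ext)
       (simp add: D_def fps_mult_nth pderiv_sum pderiv_mult sum.distrib, simp add: mult.commute)
  have "D 1 = 0" by (rule fps_ext) (simp add: D_def)
  then have "D (F ^ Suc k) = of_nat (Suc k) * F ^ k * D F"
    by (induction k) (simp_all only: power_Suc mult, simp_all add: algebra_simps)
  then show ?thesis by (simp only: D_def)
qed

text \<open>With u = t^2 - 2xt, the x-derivative of (1 + u)^(-a) is 2at (1 + u)^(-a-1), since du/dx
  = -2t. Comparing coefficients of t^(m+1) gives the claim.\<close>

lemma pderiv_gegenbauer: "pderiv (gegenbauer a (Suc m)) = smult (2 * a) (gegenbauer (a + 1) m)"
proof -
  define u :: "real poly fps" where "u = fps_X\<^sup>2 - fps_const [:0, 2:] * fps_X"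
  have Du: "Abs_fps (\<lambda>i. pderiv (fps_nth u i)) = - (fps_const [:2:]) * fps_X"
    by (rule fps_ext) (auto simp: u_def fps_X_power_nth pderiv_pCons)
  \<comment> \<open>The factor t in du/dx = -2t is what lowers the coefficient index from
    \<open>Suc m\<close> to \<open>m\<close>.\<close>
  have pw: "pderiv (fps_nth (u ^ k) (Suc m)) =
      (if k = 0 then 0 else - smult (2 * real k) (fps_nth (u ^ (k - 1)) m))" for k
  proof (cases k)
    case (Suc j)
    have "pderiv (fps_nth (u ^ k) (Suc m))
        = fps_nth (of_nat k * u ^ j * (- (fps_const [:2:]) * fps_X)) (Suc m)"
      using pderiv_fps_power[of u j, unfolded Du]
      by (simp only: Suc fps_eq_iff fps_nth_Abs_fps)
    also have "of_nat k * u ^ j * (- (fps_const [:2:]) * fps_X)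
        = fps_const (- [:2 * real k:]) * (fps_X * u ^ j)"
    proof -
      have "- [:2 * real k:] = of_nat k * (- [:2:])" by (simp add: of_nat_poly)
      then have "fps_const (- [:2 * real k:]) = of_nat k * (- (fps_const [:2:]))"
        by (simp only: fps_const_mult[symmetric] fps_const_neg[symmetric] fps_of_nat)
      then show ?thesis by (simp only: mult_ac)
    qed
    also have "fps_nth (fps_const (- [:2 * real k:]) * (fps_X * u ^ j)) (Suc m)
        = - smult (2 * real k) (fps_nth (u ^ j) m)"
      by simp
    finally show ?thesis using Suc by (simp only: diff_Suc_1 if_False nat.simps)
  qed auto
  have "pderiv (gegenbauer a (Suc m)) =
      (\<Sum>k\<le>Suc m. smult ((- a) gchoose k) (pderiv (fps_nth (u ^ k) (Suc m))))"
    by (simp add: gegenbauer_def u_def[symmetric] fps_compose_nth pderiv_sum pderiv_smult atLeast0AtMost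
        del: sum.atMost_Suc)
  also have "\<dots> = (\<Sum>k\<le>m. smult ((- a) gchoose Suc k) (- smult (2 * real (Suc k)) (fps_nth (u ^ k) m)))"
    by (subst sum.atMost_Suc_shift) (simp add: pw del: power_Suc)
  also have "\<dots> = (\<Sum>k\<le>m. smult (2 * a) (smult ((- (a + 1)) gchoose k) (fps_nth (u ^ k) m)))"
  proof (rule sum.cong[OF refl])
    fix k
    have "real (Suc k) * ((- a) gchoose Suc k) = - a * ((- (a + 1)) gchoose k)"
      using gbinomial_absorption[of k "- a"] by simp
    then have "- (((- a) gchoose Suc k) * (2 * real (Suc k))) = 2 * a * ((- (a + 1)) gchoose k)"
      by (simp add: algebra_simps)
    then show "smult ((- a) gchoose Suc k) (- smult (2 * real (Suc k)) (fps_nth (u ^ k) m))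
        = smult (2 * a) (smult ((- (a + 1)) gchoose k) (fps_nth (u ^ k) m))"
      by (simp only: smult_minus_right smult_smult mult_minus_right flip: smult_minus_left)
  qed
  also have "\<dots> = smult (2 * a) (gegenbauer (a + 1) m)"
    by (simp add: gegenbauer_def u_def[symmetric] fps_compose_nth atLeast0AtMost smult_sum_right)
  finally show ?thesis .
qed

section \<open>Parameter 1: Chebyshev polynomials of the second kind\<close>

text \<open>For a = 1 the outer series is the geometric series 1/(1 + u), so the generating series
  times 1 - 2xt + t^2 equals 1. The coefficients of this identity are the three claims.\<close>

lemma gegenbauer_one_rec:
  "gegenbauer 1 0 = 1"
  "gegenbauer 1 (Suc 0) = [:0, 2:]"
  "gegenbauer 1 (Suc (Suc m)) = [:0, 2:] * gegenbauer 1 (Suc m) - gegenbauer 1 m"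
proof -
  define u :: "real poly fps" where "u = fps_X\<^sup>2 - fps_const [:0, 2:] * fps_X"
  define A :: "real poly fps" where "A = Abs_fps (\<lambda>k. [:(- 1) gchoose k:])"
  have u0: "fps_nth u 0 = 0" by (simp add: u_def)
  have ch: "((- 1 :: real) gchoose k) = (- 1) ^ k" for k
    using gbinomial_minus[of "1::real" k] by (simp add: gbinomial_binomial[symmetric] flip: binomial_gbinomial)
  have "A * (1 + fps_X) = 1"
    by (rule fps_ext) (auto simp: A_def distrib_left ch power_eq_if one_pCons)
  then have "(A oo u) * (1 + u) = 1"
    using fps_compose_mult_distrib[OF u0, of A "1 + fps_X"]
    by (simp add: fps_compose_add_distrib fps_X_fps_compose_startby0[OF u0])
  then have eq: "fps_nth ((A oo u) * (1 + u)) k = fps_nth 1 k" for k by simp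
  have g: "gegenbauer 1 k = fps_nth (A oo u) k" for k
    by (simp add: gegenbauer_def A_def u_def)
  have *: "(A oo u) * (1 + u) = (A oo u) + fps_X^2 * (A oo u) - fps_X * (fps_const [:0, 2:] * (A oo u))"
    by (simp add: u_def algebra_simps)
  show g0: "gegenbauer 1 0 = 1"
    using eq[of 0] by (simp add: * g)
  show "gegenbauer 1 (Suc 0) = [:0, 2:]"
    using eq[of 1] g0 by (simp add: * g fps_X_power_mult_nth)
  show "gegenbauer 1 (Suc (Suc m)) = [:0, 2:] * gegenbauer 1 (Suc m) - gegenbauer 1 m"
  proof -
    have "gegenbauer 1 (Suc (Suc m)) + gegenbauer 1 m - [:0, 2:] * gegenbauer 1 (Suc m) = 0"
      using eq[of "Suc (Suc m)"] unfolding * by (simp add: g fps_X_power_mult_nth)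
    then show ?thesis by algebra
  qed
qed


section \<open>The Gegenbauer differential equation\<close>

text \<open>A first-order linear system for two consecutive polynomials. The two identities need a
  joint induction: the next \<open>?A\<close> comes from \<open>?B\<close> and the recurrence, the
  next \<open>?B\<close> from both identities and the differentiated recurrence.\<close>

lemma chebyshev_deriv:
  shows "[:-1, 0, 1:] * pderiv (gegenbauer 1 m) =
           smult (real (Suc m)) (gegenbauer 1 (Suc m)) - [:0, real m + 2:] * gegenbauer 1 m" (is "?A m")
    and "[:-1, 0, 1:] * pderiv (gegenbauer 1 (Suc m)) =
           [:0, real m + 1:] * gegenbauer 1 (Suc m) - smult (real m + 2) (gegenbauer 1 m)" (is "?B m")
proof -
  have "?A m \<and> ?B m"
  proof (induction m)
    case 0
    show ?case by (simp add: gegenbauer_one_rec pderiv_pCons)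
  next
    case (Suc m)
    let ?U = "gegenbauer 1"
    have rec: "?U (Suc (Suc m)) = [:0, 2:] * ?U (Suc m) - ?U m"
      by (rule gegenbauer_one_rec)
    have B: "[:-1, 0, 1:] * pderiv (?U (Suc m)) = [:0, real m + 1:] * ?U (Suc m) - smult (real m + 2) (?U m)"
      and A: "[:-1, 0, 1:] * pderiv (?U m) = smult (real (Suc m)) (?U (Suc m)) - [:0, real m + 2:] * ?U m"
      using Suc.IH by auto
    have D: "pderiv (?U (Suc (Suc m))) = smult 2 (?U (Suc m)) + [:0, 2:] * pderiv (?U (Suc m)) - pderiv (?U m)"
      by (simp add: rec pderiv_diff pderiv_mult pderiv_pCons pderiv_smult)
    have "[:-1, 0, 1:] * pderiv (?U (Suc (Suc m))) =
        smult 2 ([:-1, 0, 1:] * ?U (Suc m)) + [:0, 2:] * ([:-1, 0, 1:] * pderiv (?U (Suc m)))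
        - [:-1, 0, 1:] * pderiv (?U m)"
      unfolding D by (simp only: ring_distribs mult_smult_right mult.left_commute)
    then have *: "poly ([:-1, 0, 1:] * pderiv (?U (Suc (Suc m)))) x =
        poly (smult 2 ([:-1, 0, 1:] * ?U (Suc m)) + [:0, 2:] * ([:0, real m + 1:] * ?U (Suc m) - smult (real m + 2) (?U m))
        - (smult (real (Suc m)) (?U (Suc m)) - [:0, real m + 2:] * ?U m)) x" for x
      by (simp only: A B)
    have "?A (Suc m)"
      by (subst poly_eq_poly_eq_iff[symmetric], rule ext, subst B)
         (simp add: rec algebra_simps power2_eq_square)
    moreover have "?B (Suc m)"
      by (subst poly_eq_poly_eq_iff[symmetric], rule ext, subst *)
         (simp add: rec algebra_simps power2_eq_square)
    ultimately show ?case by blast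
  qed
  then show "?A m" "?B m" by auto
qed

text \<open>Differentiating the first identity of the system and eliminating \<open>V\<close> and
  its derivative leaves a second-order equation for \<open>U\<close> alone.\<close>

lemma chebyshev_ode:
  "[:-1, 0, 1:] * pderiv (pderiv (gegenbauer 1 m)) + [:0, 3:] * pderiv (gegenbauer 1 m)
   = smult (real m * (real m + 2)) (gegenbauer 1 m)"
proof -
  let ?q = "[:-1, 0, 1:] :: real poly"
  define U V where "U = gegenbauer 1 m" and "V = gegenbauer 1 (Suc m)"
  have A: "?q * pderiv U = smult (real (Suc m)) V - [:0, real m + 2:] * U"
    and B: "?q * pderiv V = [:0, real m + 1:] * V - smult (real m + 2) U"
    using chebyshev_deriv[of m] by (auto simp: U_def V_def)
  have "pderiv (?q * pderiv U) = pderiv (smult (real (Suc m)) V - [:0, real m + 2:] * U)"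
    using A by simp
  then have D: "poly (pderiv (?q * pderiv U)) x = poly (pderiv (smult (real (Suc m)) V - [:0, real m + 2:] * U)) x" for x
    by simp
  \<comment> \<open>The elimination yields the equation multiplied by x^2 - 1. This factor is
    cancelled in the polynomial ring, so the points 1 and -1 need no separate argument.\<close>
  have pt: "poly (?q * (?q * pderiv (pderiv U) + [:0, 3:] * pderiv U)) x
      = poly (?q * smult (real m * (real m + 2)) U) x" for x
  proof -
    have A': "(x\<^sup>2 - 1) * poly (pderiv U) x = (real m + 1) * poly V x - (real m + 2) * x * poly U x"
      using arg_cong[OF A, of "\<lambda>p. poly p x"] by (simp add: algebra_simps power2_eq_square)
    have B': "(x\<^sup>2 - 1) * poly (pderiv V) x = (real m + 1) * x * poly V x - (real m + 2) * poly U x"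
      using arg_cong[OF B, of "\<lambda>p. poly p x"] by (simp add: algebra_simps power2_eq_square)
    have D': "(x\<^sup>2 - 1) * poly (pderiv (pderiv U)) x + 2 * x * poly (pderiv U) x
      = (real m + 1) * poly (pderiv V) x - (real m + 2) * poly U x - (real m + 2) * x * poly (pderiv U) x"
      using D[of x]
      by (simp add: pderiv_diff pderiv_mult pderiv_pCons pderiv_smult algebra_simps power2_eq_square)
    have "(x\<^sup>2 - 1) * ((x\<^sup>2 - 1) * poly (pderiv (pderiv U)) x + 3 * x * poly (pderiv U) x)
        = (x\<^sup>2 - 1) * (real m * (real m + 2) * poly U x)"
      using A' B' D' by algebra
    then show ?thesis by (simp add: algebra_simps power2_eq_square)
  qed
  then have "?q * (?q * pderiv (pderiv U) + [:0, 3:] * pderiv U) = ?q * smult (real m * (real m + 2)) U"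
    by (simp only: poly_eq_poly_eq_iff[symmetric] fun_eq_iff) simp
  then show ?thesis unfolding U_def by (simp only: mult_cancel_left) simp
qed

text \<open>Differentiating the equation of degree \<open>Suc d\<close> for \<open>n\<close> gives
  the one of degree \<open>d\<close> for \<open>Suc n\<close>, because (d+1)(d+2n+3) - (2n+3) =
  d(d+2n+4).\<close>

lemma gegenbauer_ode:
  "[:-1, 0, 1:] * pderiv (pderiv (gegenbauer (real n + 1) d))
     + [:0, 2 * real n + 3:] * pderiv (gegenbauer (real n + 1) d)
   = smult (real d * (real d + 2 * real n + 2)) (gegenbauer (real n + 1) d)"
proof (induction n arbitrary: d)
  case 0
  show ?case using chebyshev_ode[of d] by simp
next
  case (Suc n)
  define p where "p = gegenbauer (real n + 1) (Suc d)"
  define c where "c = 2 * (real n + 1)"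
  have c: "c > 0" by (simp add: c_def)
  have dp: "pderiv p = smult c (gegenbauer (real (Suc n) + 1) d)"
    unfolding p_def c_def pderiv_gegenbauer by (simp add: add_ac)
  then have g: "gegenbauer (real (Suc n) + 1) d = smult (1 / c) (pderiv p)"
    using c by simp
  have "pderiv ([:-1, 0, 1:] * pderiv (pderiv p) + [:0, 2 * real n + 3:] * pderiv p)
      = pderiv (smult (real (Suc d) * (real (Suc d) + 2 * real n + 2)) p)"
    using Suc.IH[of "Suc d"] by (simp only: p_def)
  then have D: "poly (pderiv ([:-1, 0, 1:] * pderiv (pderiv p) + [:0, 2 * real n + 3:] * pderiv p)) x
      = poly (pderiv (smult (real (Suc d) * (real (Suc d) + 2 * real n + 2)) p)) x" for x
    by simp
  have "[:-1, 0, 1:] * pderiv (pderiv (pderiv p)) + [:0, 2 * real (Suc n) + 3:] * pderiv (pderiv p)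
      = smult (real d * (real d + 2 * real (Suc n) + 2)) (pderiv p)"
  proof (subst poly_eq_poly_eq_iff[symmetric], rule ext)
    fix x
    show "poly ([:-1, 0, 1:] * pderiv (pderiv (pderiv p)) + [:0, 2 * real (Suc n) + 3:] * pderiv (pderiv p)) x
      = poly (smult (real d * (real d + 2 * real (Suc n) + 2)) (pderiv p)) x"
      using D[of x] by (simp add: pderiv_add pderiv_diff pderiv_mult pderiv_pCons pderiv_smult algebra_simps)
  qed
  then have "smult (1 / c) ([:-1, 0, 1:] * pderiv (pderiv (pderiv p)) + [:0, 2 * real (Suc n) + 3:] * pderiv (pderiv p))
      = smult (1 / c) (smult (real d * (real d + 2 * real (Suc n) + 2)) (pderiv p))"
    by simp
  then show ?case
    unfolding g
    by (simp only: pderiv_smult smult_add_right mult_smult_right smult_smult mult.commute[of "1 / c"])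
qed

section \<open>Degree, parity and roots\<close>

lemma chebyshev_degree_lead_coeff:
  "degree (gegenbauer 1 m) = m \<and> coeff (gegenbauer 1 m) m = 2 ^ m"
proof (induction m rule: induct_nat_012)
  case (ge2 m)
  let ?q = "pCons 0 (smult 2 (gegenbauer 1 (Suc m)))"
  have q: "degree ?q = Suc (Suc m)"
    using ge2.IH(2) by (subst degree_pCons_eq) (auto dest: arg_cong[of _ 0 degree])
  have "gegenbauer 1 (Suc (Suc m)) = ?q + - gegenbauer 1 m"
    by (simp add: gegenbauer_one_rec)
  moreover have "degree (?q + - gegenbauer 1 m) = Suc (Suc m)"
    using q ge2.IH(1) by (subst degree_add_eq_left) auto
  moreover have "coeff (?q + - gegenbauer 1 m) (Suc (Suc m)) = 2 ^ Suc (Suc m)"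
    using ge2.IH by (simp add: coeff_eq_0)
  ultimately show ?case by simp
qed (simp_all add: gegenbauer_one_rec)

lemma chebyshev_minus: "poly (gegenbauer 1 m) (- x) = (- 1) ^ m * poly (gegenbauer 1 m) x"
  by (induction m rule: induct_nat_012) (simp_all add: gegenbauer_one_rec algebra_simps)

lemma chebyshev_cos: "poly (gegenbauer 1 m) (cos t) * sin t = sin (real (Suc m) * t)"
proof (induction m rule: induct_nat_012)
  case (ge2 m)
  have "poly (gegenbauer 1 (Suc (Suc m))) (cos t) * sin t
      = 2 * cos t * (poly (gegenbauer 1 (Suc m)) (cos t) * sin t) - poly (gegenbauer 1 m) (cos t) * sin t"
    by (simp add: gegenbauer_one_rec algebra_simps)
  also have "\<dots> = 2 * cos t * sin (real m * t + 2 * t) - sin (real m * t + t)"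
  proof -
    have "real (Suc m) * t = real m * t + t" "real (Suc (Suc m)) * t = real m * t + 2 * t"
      by (simp_all add: ring_distribs)
    then show ?thesis by (simp only: ge2.IH)
  qed
  \<comment> \<open>With A = (m+2)t, the identity 2 cos t sin A = sin (A + t) + sin (A - t) closes
    the recurrence.\<close>
  also have "sin (real m * t + t) = sin ((real m * t + 2 * t) - t)" by (simp add: algebra_simps)
  also have "2 * cos t * sin (real m * t + 2 * t) - \<dots> = sin ((real m * t + 2 * t) + t)"
    by (simp only: sin_add sin_diff) (simp add: algebra_simps)
  finally show ?case by (simp add: algebra_simps)
qed (simp_all add: gegenbauer_one_rec sin_double)

text \<open>Each gap between neighbouring points contributes one zero of the derivative. Points are
  added in increasing order, so every new zero lies to the right of the earlier ones. The strict
  bounds on \<open>t\<close> later confine the zeros to (-1, 1).\<close>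

lemma Rolle_card:
  fixes f f' :: "real \<Rightarrow> real"
  assumes "finite S" and "\<And>x. x \<in> S \<Longrightarrow> f x = 0"
    and deriv: "\<And>x. (f has_real_derivative f' x) (at x)"
  shows "\<exists>T. finite T \<and> card T = card S - 1 \<and>
    (\<forall>t\<in>T. f' t = 0 \<and> (\<exists>a\<in>S. \<exists>b\<in>S. a < t \<and> t < b))"
  using assms(1,2)
proof (induction S rule: finite_linorder_max_induct)
  case empty
  show ?case by (intro exI[of _ "{}"]) auto
next
  case (insert b A)
  show ?case
  proof (cases "A = {}")
    case True
    then show ?thesis by (intro exI[of _ "{}"]) auto
  next
    case False
    define m where "m = Max A"
    have m: "m \<in> A" "\<And>a. a \<in> A \<Longrightarrow> a \<le> m"
      using insert.hyps False by (auto simp: m_def)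
    from insert obtain T where T: "finite T" "card T = card A - 1"
      and T': "\<And>t. t \<in> T \<Longrightarrow> f' t = 0 \<and> (\<exists>a\<in>A. \<exists>b\<in>A. a < t \<and> t < b)"
      by auto
    have "m < b" using insert.hyps m by auto
    then obtain z where z: "m < z" "z < b" "f' z = 0"
      using Rolle[of m b f] insert.prems m deriv
      by (metis DERIV_isCont DERIV_unique continuous_at_imp_continuous_on insert_iff real_differentiable_def)
    have "z \<notin> T"
    proof
      assume "z \<in> T"
      then obtain a where "a \<in> A" "z < a" using T' by blast
      then show False using m(2)[of a] z by simp
    qed
    moreover have "b \<notin> A" using insert.hyps by auto
    moreover have "card A > 0" using False insert.hyps by (simp add: card_gt_0_iff)
    ultimately have "card (insert z T) = card (insert b A) - 1"
      using T insert.hyps by simp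
    moreover have "f' t = 0 \<and> (\<exists>a\<in>insert b A. \<exists>c\<in>insert b A. a < t \<and> t < c)" if "t \<in> insert z T" for t
      using that z m(1) T'[of t] by blast
    ultimately show ?thesis using T(1) by (intro exI[of _ "insert z T"]) auto
  qed
qed

lemma chebyshev_roots:
  "\<exists>S. finite S \<and> card S = m \<and> S \<subseteq> {-1<..<1} \<and> (\<forall>r\<in>S. poly (gegenbauer 1 m) r = 0)"
proof (intro exI conjI ballI)
  \<comment> \<open>By \<open>chebyshev_cos\<close> the roots are the cosines of these angles. The
    indices 0 and m+1 are left out because there sin vanishes and cannot be cancelled.\<close>
  define g where "g = (\<lambda>k. real k * pi / real (Suc m))"
  have g: "0 < g k" "g k < pi" if "k \<in> {1..m}" for k
  proof -
    show "0 < g k"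
      unfolding g_def using that by (intro divide_pos_pos mult_pos_pos) auto
    have "real k * pi < pi * real (Suc m)"
      using that by (subst mult.commute, intro mult_strict_left_mono) auto
    then show "g k < pi"
      unfolding g_def by (subst pos_divide_less_eq) (rule of_nat_0_less_iff[THEN iffD2], simp)
  qed
  have inj: "inj_on (\<lambda>k. cos (g k)) {1..m}"
  proof (rule inj_onI)
    fix i j assume ij: "i \<in> {1..m}" "j \<in> {1..m}" "cos (g i) = cos (g j)"
    have "g i = g j" by (rule cos_inj_pi) (use ij g less_imp_le in auto)
    then show "i = j" by (simp only: g_def divide_cancel_right mult_cancel_right) simp
  qed
  let ?S = "(\<lambda>k. cos (g k)) ` {1..m}"
  show "finite ?S" by simp
  show "card ?S = m" using card_image[OF inj] by simp
  show "?S \<subseteq> {-1<..<1}"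
  proof
    fix y assume "y \<in> ?S"
    then obtain k where k: "k \<in> {1..m}" "y = cos (g k)" by blast
    then show "y \<in> {-1<..<1}"
      using g[OF k(1)] cos_monotone_0_pi[of 0 "g k"] cos_monotone_0_pi[of "g k" pi] by auto
  qed
  fix r assume "r \<in> ?S"
  then obtain k where k: "k \<in> {1..m}" "r = cos (g k)" by blast
  have "sin (real (Suc m) * g k) = sin (real k * pi)" by (simp add: g_def)
  then have "poly (gegenbauer 1 m) r * sin (g k) = 0"
    by (simp only: k(2) chebyshev_cos sin_npi)
  moreover have "sin (g k) > 0" using g[OF k(1)] by (rule sin_gt_zero)
  ultimately show "poly (gegenbauer 1 m) r = 0" by simp
qed

text \<open>\<open>pderiv_gegenbauer\<close> solved for the higher parameter, as needed in
  inductions on \<open>n\<close> that call on the hypothesis at \<open>Suc d\<close>.\<close>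

lemma gegenbauer_Suc_eq:
  "gegenbauer (real (Suc n) + 1) d = smult (1 / (2 * (real n + 1))) (pderiv (gegenbauer (real n + 1) (Suc d)))"
proof -
  have "real n + 1 > 0" by linarith
  then show ?thesis by (simp add: pderiv_gegenbauer add_ac)
qed

lemma gegenbauer_degree_lead_coeff:
  "degree (gegenbauer (real n + 1) d) = d \<and> coeff (gegenbauer (real n + 1) d) d > 0"
proof (induction n arbitrary: d)
  case 0
  show ?case using chebyshev_degree_lead_coeff[of d] by simp
next
  case (Suc n)
  have "degree (gegenbauer (real n + 1) (Suc d)) = Suc d"
    "coeff (gegenbauer (real n + 1) (Suc d)) (Suc d) > 0"
    using Suc.IH by auto
  then show ?case
    unfolding gegenbauer_Suc_eq by (simp add: degree_pderiv coeff_pderiv)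
qed

lemma gegenbauer_minus:
  "poly (gegenbauer (real n + 1) d) (- x) = (- 1) ^ d * poly (gegenbauer (real n + 1) d) x"
proof (induction n arbitrary: d x)
  case 0
  show ?case using chebyshev_minus[of d] by simp
next
  case (Suc n)
  define p where "p = gegenbauer (real n + 1) (Suc d)"
  \<comment> \<open>Stated as an equality of polynomials, the parity of \<open>p\<close> can be
    differentiated; the chain rule supplies the change of sign.\<close>
  have "pcompose p [:0, -1:] = smult ((- 1) ^ Suc d) p"
    by (subst poly_eq_poly_eq_iff[symmetric], rule ext) (simp add: poly_pcompose p_def Suc.IH)
  then have "pderiv (pcompose p [:0, -1:]) = smult ((- 1) ^ Suc d) (pderiv p)"
    by (simp only: pderiv_smult)
  then have "poly (pderiv (pcompose p [:0, -1:])) x = (- 1) ^ Suc d * poly (pderiv p) x"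
    by simp
  then have "poly (pderiv p) (- x) = (- 1) ^ d * poly (pderiv p) x"
    by (simp add: pderiv_pcompose poly_pcompose pderiv_pCons)
  then show ?case
    unfolding gegenbauer_Suc_eq p_def[symmetric] by simp
qed

text \<open>Rolle's theorem turns the d+1 roots for \<open>n\<close> into d roots for
  \<open>Suc n\<close>, all between the old ones.\<close>

lemma gegenbauer_roots:
  "\<exists>S. finite S \<and> card S = d \<and> S \<subseteq> {-1<..<1} \<and> (\<forall>r\<in>S. poly (gegenbauer (real n + 1) d) r = 0)"
proof (induction n arbitrary: d)
  case 0
  show ?case using chebyshev_roots[of d] by simp
next
  case (Suc n)
  define p where "p = gegenbauer (real n + 1) (Suc d)"
  obtain S where S: "finite S" "card S = Suc d" "S \<subseteq> {-1<..<1}" "\<And>r. r \<in> S \<Longrightarrow> poly p r = 0"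
    using Suc.IH[of "Suc d"] unfolding p_def by blast
  obtain T where T: "finite T" "card T = d"
    and T': "\<And>t. t \<in> T \<Longrightarrow> poly (pderiv p) t = 0 \<and> (\<exists>a\<in>S. \<exists>b\<in>S. a < t \<and> t < b)"
    using Rolle_card[of S "poly p" "poly (pderiv p)"] S by auto
  have "T \<subseteq> {-1<..<1}"
  proof
    fix t assume "t \<in> T"
    with T' obtain a b where "a \<in> S" "b \<in> S" "a < t" "t < b" by blast
    moreover from this S(3) have "-1 < a" "b < 1" by auto
    ultimately show "t \<in> {-1<..<1}" by simp
  qed
  with T T' show ?case
    unfolding gegenbauer_Suc_eq p_def[symmetric] by (intro exI[of _ T]) auto
qed

section \<open>Factorization over the roots and logarithmic derivatives\<close>

text \<open>The two sides agree in the coefficient of index \<open>degree p\<close> and at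
  \<open>degree p\<close> points, which determines a polynomial of that degree.\<close>

lemma poly_eq_prod_roots:
  fixes p :: "real poly"
  assumes "finite S" "card S = degree p" "\<And>r. r \<in> S \<Longrightarrow> poly p r = 0"
  shows "p = smult (lead_coeff p) (\<Prod>r\<in>S. [:- r, 1:])"
proof -
  have m: "lead_coeff (\<Prod>r\<in>S. [:- r, 1:]) = 1" by (simp add: lead_coeff_prod)
  have deg: "degree (\<Prod>r\<in>S. [:- r, 1:]) = card S"
    by (subst degree_prod_eq_sum_degree) auto
  show ?thesis
  proof (rule poly_eqI_degree_lead_coeff[of _ "degree p" _ S])
    show "coeff p (degree p) = coeff (smult (lead_coeff p) (\<Prod>r\<in>S. [:- r, 1:])) (degree p)"
    proof -
      have "coeff (\<Prod>r\<in>S. [:- r, 1:]) (degree p) = 1"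
        using m by (simp only: deg assms(2))
      then show ?thesis by simp
    qed
    show "poly p z = poly (smult (lead_coeff p) (\<Prod>r\<in>S. [:- r, 1:])) z" if "z \<in> S" for z
    proof -
      have "(\<Prod>r\<in>S. z - r) = 0" using that assms(1) by (intro prod_zero) auto
      then show ?thesis using that assms(3) by (simp add: poly_prod)
    qed
  qed (use assms deg in auto)
qed

text \<open>With u = p'/p this reads p' = p u and p'' = p (u^2 + u'), where u' is minus the sum of
  the inverse squares.\<close>

lemma poly_prod_roots_pderiv:
  fixes S :: "real set" and c :: real
  defines "p \<equiv> smult c (\<Prod>r\<in>S. [:- r, 1:])"
  assumes S: "finite S" and x: "x \<notin> S"
  shows "poly (pderiv p) x = poly p x * (\<Sum>r\<in>S. 1 / (x - r))"
    and "poly (pderiv (pderiv p)) x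
         = poly p x * ((\<Sum>r\<in>S. 1 / (x - r))\<^sup>2 - (\<Sum>r\<in>S. 1 / (x - r)\<^sup>2))"
proof -
  let ?u = "\<lambda>y. \<Sum>r\<in>S. 1 / (y - r)"
  have p: "poly p y = c * (\<Prod>r\<in>S. y - r)" for y
    by (simp add: p_def poly_prod)
  have first: "poly (pderiv p) y = poly p y * ?u y" if "y \<notin> S" for y
  proof -
    have "((\<lambda>y. \<Prod>r\<in>S. y - r) has_real_derivative (\<Prod>r\<in>S. y - r) * (\<Sum>r\<in>S. 1 / (y - r))) (at y)"
      using that by (intro has_field_derivative_prod') (auto intro!: derivative_eq_intros)
    then have "((\<lambda>y. c * (\<Prod>r\<in>S. y - r)) has_real_derivative c * ((\<Prod>r\<in>S. y - r) * ?u y)) (at y)"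
      by (rule DERIV_cmult)
    moreover have "(\<lambda>y. c * (\<Prod>r\<in>S. y - r)) = poly p" by (simp add: fun_eq_iff p)
    ultimately have "(poly p has_real_derivative poly p y * ?u y) (at y)"
      by (simp only: p mult.assoc)
    then show ?thesis using poly_DERIV DERIV_unique by blast
  qed
  show "poly (pderiv p) x = poly p x * ?u x" using first x by blast
  have "(?u has_real_derivative (\<Sum>r\<in>S. - (1 / (x - r)\<^sup>2))) (at x)"
    using x by (auto intro!: derivative_eq_intros simp: power2_eq_square)
  then have "((\<lambda>y. poly p y * ?u y) has_real_derivative
      poly (pderiv p) x * ?u x + (\<Sum>r\<in>S. - (1 / (x - r)\<^sup>2)) * poly p x) (at x)"
    by (intro DERIV_mult poly_DERIV)
  moreover have "((\<lambda>y. poly p y * ?u y) has_real_derivative poly (pderiv (pderiv p)) x) (at x)"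
    \<comment> \<open>The formula p' = p u is available only off \<open>S\<close>; the complement of
      the finite set \<open>S\<close> is an open neighbourhood of \<open>x\<close>.\<close>
    by (rule has_field_derivative_transform_within_open[where S = "- S" and f = "poly (pderiv p)"])
       (use S x first in \<open>auto intro: finite_imp_closed\<close>)
  ultimately have "poly (pderiv (pderiv p)) x
      = poly (pderiv p) x * ?u x + (\<Sum>r\<in>S. - (1 / (x - r)\<^sup>2)) * poly p x"
    by (rule DERIV_unique[symmetric])
  then show "poly (pderiv (pderiv p)) x = poly p x * ((?u x)\<^sup>2 - (\<Sum>r\<in>S. 1 / (x - r)\<^sup>2))"
    using first[OF x] by (simp add: sum_negf power2_eq_square algebra_simps)
qed

section \<open>Two sign estimates\<close>

text \<open>The terms for r and -r add up to a fraction with numerator 2(x^2 + r^2 - 2r^4), which is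
  nonnegative because r^2 \<le> x^2 and r^4 \<le> r^2.\<close>

lemma symmetric_roots_sum_nonneg:
  fixes S :: "real set"
  assumes S: "S \<subseteq> {-1<..<1}" and sym: "\<And>r. r \<in> S \<Longrightarrow> - r \<in> S"
    and x: "\<And>r. r \<in> S \<Longrightarrow> r < x"
  shows "0 \<le> (\<Sum>r\<in>S. (1 + x * r - 2 * r\<^sup>2) / (x - r)\<^sup>2)"
proof -
  let ?f = "\<lambda>r. (1 + x * r - 2 * r\<^sup>2) / (x - r)\<^sup>2"
  have "sum ?f S = (\<Sum>r\<in>S. ?f (- r))"
    by (rule sum.reindex_bij_witness[of _ uminus uminus]) (auto simp: sym)
  \<comment> \<open>Doubling the sum, rather than splitting \<open>S\<close> into pairs, also covers
    a root at 0.\<close>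
  then have "2 * sum ?f S = (\<Sum>r\<in>S. ?f r + ?f (- r))"
    by (simp add: sum.distrib)
  also have "\<dots> \<ge> 0"
  proof (rule sum_nonneg)
    fix r assume r: "r \<in> S"
    have rx: "r < x" "- r < x" using x[OF r] x[OF sym[OF r]] by auto
    then have r2: "r\<^sup>2 \<le> x\<^sup>2" by (intro power2_le_iff_abs_le[THEN iffD2]) auto
    have "-1 < r" "r < 1" using r S by auto
    then have "\<bar>r\<bar> \<le> 1" by simp
    then have "r\<^sup>2 * r\<^sup>2 \<le> r\<^sup>2 * 1" by (intro mult_left_mono) (auto simp: abs_square_le_1)
    then have num: "0 \<le> x\<^sup>2 + r\<^sup>2 - 2 * (r\<^sup>2 * r\<^sup>2)" using r2 by linarith
    have ne: "x - r \<noteq> 0" "x + r \<noteq> 0" using rx by auto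
    have "?f r + ?f (- r) = ((1 + x * r - 2 * r\<^sup>2) * (x + r)\<^sup>2 + (1 - x * r - 2 * r\<^sup>2) * (x - r)\<^sup>2)
        / ((x - r)\<^sup>2 * (x + r)\<^sup>2)"
      using ne by (simp add: add_frac_eq)
    also have "(1 + x * r - 2 * r\<^sup>2) * (x + r)\<^sup>2 + (1 - x * r - 2 * r\<^sup>2) * (x - r)\<^sup>2
        = 2 * (x\<^sup>2 + r\<^sup>2 - 2 * (r\<^sup>2 * r\<^sup>2))"
      by (simp add: power2_eq_square algebra_simps)
    finally show "0 \<le> ?f r + ?f (- r)" using num by simp
  qed
  finally show ?thesis by simp
qed

text \<open>The square of \<open>gamma_nd n d\<close> is the value of x^2 at which the quadratic
  expression vanishes.\<close>

lemma discriminant_pos: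
  assumes d: "d \<ge> 1" and x: "x > gamma_nd n d"
  shows "0 \<le> gamma_nd n d" and "0 < (real n + real d)\<^sup>2 * (x\<^sup>2 - 1) + (real n)\<^sup>2"
proof -
  let ?q = "(real n)\<^sup>2 / (real (n + d))\<^sup>2"
  have q: "?q \<le> 1" by (simp add: divide_le_eq_1 power_mono)
  then show g0: "0 \<le> gamma_nd n d" by (simp add: gamma_nd_def)
  have "(gamma_nd n d)\<^sup>2 < x\<^sup>2" using x g0 by (intro power_strict_mono) auto
  then have "1 - ?q < x\<^sup>2" using q by (simp add: gamma_nd_def)
  then have "0 < (real (n + d))\<^sup>2 * (x\<^sup>2 - 1 + ?q)" using d by (intro mult_pos_pos) auto
  also have "\<dots> = (real (n + d))\<^sup>2 * (x\<^sup>2 - 1) + (real n)\<^sup>2" using d by (simp add: distrib_left)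
  finally show "0 < (real n + real d)\<^sup>2 * (x\<^sup>2 - 1) + (real n)\<^sup>2" by simp
qed

section \<open>Comparing the logarithmic derivative with the roots of a quadratic\<close>

theorem corollary6p10:
  fixes n d :: nat
  assumes "d \<ge> 1"
  shows "maxroot (gegenbauer (real n + 1) d) \<le> gamma_nd n d \<and>
         (\<forall>x::real. x > gamma_nd n d \<longrightarrow>
            cauchy_transform (gegenbauer (real n + 1) d) x \<le> cauchy_bound n d x)"
proof -
  define p where "p = gegenbauer (real n + 1) d"
  have deg: "degree p = d" and lc: "lead_coeff p > 0"
    using gegenbauer_degree_lead_coeff[of n d] by (auto simp: p_def)
  obtain S where S: "finite S" "card S = d" "S \<subseteq> {-1<..<1}" and root: "\<And>r. r \<in> S \<Longrightarrow> poly p r = 0"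
    using gegenbauer_roots[of d n] unfolding p_def by blast
  have p_eq: "p = smult (lead_coeff p) (\<Prod>r\<in>S. [:- r, 1:])"
    using S root deg by (intro poly_eq_prod_roots) auto
  have poly_p: "poly p x = lead_coeff p * (\<Prod>r\<in>S. x - r)" for x
    by (subst p_eq) (simp add: poly_prod)
  have roots: "{x. poly p x = 0} = S"
    using S(1) lc by (auto simp: poly_p)
  have sym: "- r \<in> S" if "r \<in> S" for r
    using that gegenbauer_minus[of n d r] unfolding roots[symmetric] p_def by simp
  define \<rho> where "\<rho> = Max S"
  have "S \<noteq> {}" using S assms by auto
  then have \<rho>: "\<rho> \<in> S" "\<And>r. r \<in> S \<Longrightarrow> r \<le> \<rho>"
    using S(1) by (auto simp: \<rho>_def)
  then have \<rho>1: "\<rho> < 1" and \<rho>0: "0 \<le> \<rho>"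
    using S(3) sym[of \<rho>] \<rho>(2)[of "- \<rho>"] by auto
  define u where "u = (\<lambda>x. \<Sum>r\<in>S. 1 / (x - r))"
  define D where "D = (\<lambda>x. (real n + real d)\<^sup>2 * (x\<^sup>2 - 1) + (real n)\<^sup>2)"
  \<comment> \<open>To the right of \<open>\<rho>\<close> this is p times (x^2 - 1) u + n x. As a
    polynomial it is also defined at \<open>\<rho>\<close>, where u has a pole, so the intermediate
    value theorem applies from \<open>\<rho>\<close> on.\<close>
  define W where "W = [:-1, 0, 1:] * pderiv p + [:0, real n:] * p"
  have W: "poly W x = (x\<^sup>2 - 1) * poly (pderiv p) x + real n * x * poly p x" for x
    by (simp add: W_def power2_eq_square algebra_simps)
  have pos: "poly p x > 0" if "x > \<rho>" for x
  proof -
    have "(\<Prod>r\<in>S. x - r) > 0" using that \<rho>(2) by (intro prod_pos) force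
    then show ?thesis using lc by (simp add: poly_p)
  qed
  have u_pos: "u x > 0" if "x > \<rho>" for x
    unfolding u_def using that \<rho>(2) \<open>S \<noteq> {}\<close> S(1) by (intro sum_pos) force+
  have dp: "poly (pderiv p) x = poly p x * u x" if "x > \<rho>" for x
  proof -
    have "x \<notin> S" using that \<rho>(2)[of x] by auto
    from poly_prod_roots_pderiv(1)[OF S(1) this, of "lead_coeff p"] show ?thesis
      by (simp only: u_def p_eq[symmetric])
  qed
  have W_u: "poly W x = poly p x * ((x\<^sup>2 - 1) * u x + real n * x)" if "x > \<rho>" for x
    using dp[OF that] by (simp add: W algebra_simps)
  have quad: "(x\<^sup>2 - 1) * (u x)\<^sup>2 + 2 * real n * x * u x - real d * (2 * real n + real d) \<le> 0"
    if "x > \<rho>" for x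
  proof -
    define v where "v = (\<Sum>r\<in>S. 1 / (x - r)\<^sup>2)"
    have x: "r < x" if "r \<in> S" for r using \<rho>(2)[OF that] \<open>x > \<rho>\<close> by linarith
    then have "x \<notin> S" by auto
    have ddp: "poly (pderiv (pderiv p)) x = poly p x * ((u x)\<^sup>2 - v)"
      using poly_prod_roots_pderiv(2)[OF S(1) \<open>x \<notin> S\<close>, of "lead_coeff p"]
      by (simp only: u_def v_def p_eq[symmetric])
    have "(x\<^sup>2 - 1) * poly (pderiv (pderiv p)) x + (2 * real n + 3) * x * poly (pderiv p) x
        = real d * (real d + 2 * real n + 2) * poly p x"
      using arg_cong[OF gegenbauer_ode[of n d], of "\<lambda>q. poly q x"]
      by (simp add: p_def power2_eq_square algebra_simps)
    then have "poly p x * ((x\<^sup>2 - 1) * ((u x)\<^sup>2 - v) + (2 * real n + 3) * x * u x)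
        = poly p x * (real d * (real d + 2 * real n + 2))"
      unfolding ddp dp[OF that] by (simp add: algebra_simps)
    then have ode: "(x\<^sup>2 - 1) * ((u x)\<^sup>2 - v) + (2 * real n + 3) * x * u x
        = real d * (real d + 2 * real n + 2)"
      using pos[OF that] by simp
    \<comment> \<open>Expanding the numerator in powers of x - r shows that these terms sum to
      exactly what separates \<open>ode\<close> from the quadratic in \<open>u x\<close>.\<close>
    have "(1 + x * r - 2 * r\<^sup>2) / (x - r)\<^sup>2
        = 3 * x * (1 / (x - r)) - (x\<^sup>2 - 1) * (1 / (x - r)\<^sup>2) - 2" if "r \<in> S" for r
    proof -
      have eq: "1 + x * r - 2 * r\<^sup>2 = 3 * x * (x - r) - (x\<^sup>2 - 1) - 2 * (x - r)\<^sup>2"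
        by (simp add: power2_eq_square algebra_simps)
      have "x - r \<noteq> 0" using x[OF that] by simp
      then show ?thesis unfolding eq by (simp add: diff_divide_distrib power2_eq_square)
    qed
    then have "(\<Sum>r\<in>S. (1 + x * r - 2 * r\<^sup>2) / (x - r)\<^sup>2) = 3 * x * u x - (x\<^sup>2 - 1) * v - 2 * real d"
      unfolding u_def v_def using S(2) by (simp add: sum_subtractf sum_distrib_left)
    moreover have "0 \<le> (\<Sum>r\<in>S. (1 + x * r - 2 * r\<^sup>2) / (x - r)\<^sup>2)"
      using S(3) sym x by (rule symmetric_roots_sum_nonneg)
    ultimately show ?thesis using ode by (simp add: algebra_simps)
  qed
  \<comment> \<open>Completing the square. Together with \<open>quad\<close> it puts the square
    above \<open>D x\<close> for \<bar>x\<bar> < 1 and below it for \<bar>x\<bar> > 1, as long as x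
    > \<open>\<rho>\<close>.\<close>
  have square: "(x\<^sup>2 - 1) * ((x\<^sup>2 - 1) * (u x)\<^sup>2 + 2 * real n * x * u x - real d * (2 * real n + real d))
      = ((x\<^sup>2 - 1) * u x + real n * x)\<^sup>2 - D x" for x
    by (simp add: D_def power2_eq_square algebra_simps)
  have D_pos: "D x > 0" and \<gamma>0: "gamma_nd n d \<ge> 0" if "x > gamma_nd n d" for x
    using discriminant_pos[OF assms that] by (auto simp: D_def)
  have x2: "x\<^sup>2 < 1" if "0 \<le> x" "x < 1" for x :: real
    using that by (simp add: abs_square_less_1)
  have W_nz: "poly W x \<noteq> 0" if "x > \<rho>" "x > gamma_nd n d" "x < 1" for x
  proof
    assume "poly W x = 0"
    then have "(x\<^sup>2 - 1) * u x + real n * x = 0" using W_u[OF that(1)] pos[OF that(1)] by simp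
    then have "(x\<^sup>2 - 1) * ((x\<^sup>2 - 1) * (u x)\<^sup>2 + 2 * real n * x * u x - real d * (2 * real n + real d)) < 0"
      using D_pos[OF that(2)] by (simp add: square)
    moreover have "x\<^sup>2 - 1 < 0" using x2[of x] that(1,3) \<rho>0 by simp
    ultimately show False using quad[OF that(1)] by (simp add: mult_less_0_iff)
  qed
  \<comment> \<open>For n = 0 the value of \<open>gamma_nd\<close> is 1. Positivity of n makes W(1)
    = n p(1) positive.\<close>
  have n_pos: "n > 0" if "gamma_nd n d < 1"
    using that by (cases n) (auto simp: gamma_nd_def)
  have W1: "poly W 1 > 0" if "gamma_nd n d < 1"
    using n_pos[OF that] pos[OF \<rho>1] by (simp add: W)
  have max: "\<rho> \<le> gamma_nd n d"
  proof (rule ccontr)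
    assume "\<not> \<rho> \<le> gamma_nd n d"
    then have g: "gamma_nd n d < \<rho>" by simp
    \<comment> \<open>This is p divided by x - \<open>\<rho>\<close>, so p'(\<open>\<rho>\<close>) =
      q(\<open>\<rho>\<close>), a product of positive factors. Hence W is negative at
      \<open>\<rho>\<close> and must vanish before 1, against \<open>W_nz\<close>.\<close>
    define q where "q = smult (lead_coeff p) (\<Prod>r\<in>S - {\<rho>}. [:- r, 1:])"
    have "p = [:- \<rho>, 1:] * q"
      by (subst p_eq) (simp only: q_def prod.remove[OF S(1) \<rho>(1)] mult_smult_right)
    then have "poly (pderiv p) \<rho> = poly (pderiv ([:- \<rho>, 1:] * q)) \<rho>" by (simp only:)
    also have "\<dots> = poly q \<rho>"
      unfolding pderiv_mult by (simp add: pderiv_pCons)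
    also have "\<dots> > 0"
    proof -
      have "(\<Prod>r\<in>S - {\<rho>}. \<rho> - r) > 0"
        using \<rho>(2) by (intro prod_pos) (metis DiffE diff_gt_0_iff_gt insertI1 less_eq_real_def)
      then show ?thesis using lc by (simp add: q_def poly_prod)
    qed
    finally have "poly W \<rho> < 0"
      using root[OF \<rho>(1)] x2[OF \<rho>0 \<rho>1] by (simp add: W mult_less_0_iff)
    then obtain y where "\<rho> < y" "y < 1" "poly W y = 0"
      using poly_IVT_pos[of \<rho> 1 W] W1 g \<rho>1 by auto
    then show False using W_nz[of y] g by simp
  qed
  have bound: "cauchy_transform p x \<le> cauchy_bound n d x" if x: "x > gamma_nd n d" for x
  proof -
    have x\<rho>: "x > \<rho>" and x0: "x > 0" using x max \<gamma>0[OF x] by auto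
    have ct: "cauchy_transform p x = u x / real d"
      using dp[OF x\<rho>] pos[OF x\<rho>] by (simp add: cauchy_transform_def deg)
    define v where "v = (x\<^sup>2 - 1) * u x + real n * x"
    have sq: "(x\<^sup>2 - 1) * ((x\<^sup>2 - 1) * (u x)\<^sup>2 + 2 * real n * x * u x - real d * (2 * real n + real d))
        = v\<^sup>2 - D x"
      by (simp add: square v_def)
    have cb: "cauchy_bound n d x = (sqrt (D x) - real n * x) / (x\<^sup>2 - 1) / real d" if "x \<noteq> 1"
      using that by (simp add: cauchy_bound_def D_def mult.commute)
    consider "x < 1" | "x = 1" | "x > 1" by linarith
    then show ?thesis
    proof cases
      case 1
      then have neg: "x\<^sup>2 - 1 < 0" using x2[of x] x0 by simp
      \<comment> \<open>This excludes the branch v \<le> -sqrt (D x): a negative value of W at x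
        would force a zero in (x, 1).\<close>
      have "poly W x > 0"
      proof (rule ccontr)
        assume "\<not> poly W x > 0"
        then have "poly W x < 0" using W_nz[OF x\<rho> x 1] by linarith
        then obtain y where "x < y" "y < 1" "poly W y = 0"
          using poly_IVT_pos[of x 1 W] 1 W1 x by auto
        then show False using W_nz[of y] x x\<rho> by simp
      qed
      then have "v > 0" using W_u[OF x\<rho>] pos[OF x\<rho>] by (simp add: v_def zero_less_mult_iff)
      moreover have "D x \<le> v\<^sup>2"
        using sq neg quad[OF x\<rho>] mult_nonpos_nonpos[of "x\<^sup>2 - 1"] by fastforce
      ultimately have "sqrt (D x) \<le> v" by (intro real_le_lsqrt) auto
      \<comment> \<open>Division by the negative x^2 - 1 turns the lower bound on \<open>v\<close>
        into an upper bound on \<open>u x\<close>.\<close>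
      then have "u x \<le> (sqrt (D x) - real n * x) / (x\<^sup>2 - 1)"
        using neg by (simp add: neg_le_divide_eq v_def algebra_simps)
      then have "u x / real d \<le> (sqrt (D x) - real n * x) / (x\<^sup>2 - 1) / real d"
        by (rule divide_right_mono) simp
      then show ?thesis using 1 by (simp add: ct cb)
    next
      case 2
      have "n > 0" using x 2 n_pos by simp
      \<comment> \<open>At x = 1 the quadratic term of \<open>quad\<close> drops out, and the
        remaining linear inequality gives exactly the value filled in by
        \<open>cauchy_bound\<close>.\<close>
      then have "u x \<le> real d * (2 * real n + real d) / (2 * real n)"
        using quad[OF x\<rho>] 2 by (simp add: pos_le_divide_eq mult.commute)
      then have "u x / real d \<le> real d * (2 * real n + real d) / (2 * real n) / real d"
        by (rule divide_right_mono) simp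
      then show ?thesis using 2 assms unfolding ct by (simp add: cauchy_bound_def)
    next
      case 3
      then have x2_pos: "x\<^sup>2 - 1 > 0" by (simp add: one_less_power)
      \<comment> \<open>Beyond 1 the inequality between \<open>v\<^sup>2\<close> and
        \<open>D x\<close> is reversed, and the sign of \<open>v\<close> does not matter.\<close>
      have "v\<^sup>2 \<le> D x"
        using sq x2_pos quad[OF x\<rho>] mult_nonneg_nonpos[of "x\<^sup>2 - 1"] by fastforce
      then have "v \<le> sqrt (D x)" by (rule real_le_rsqrt)
      then have "u x \<le> (sqrt (D x) - real n * x) / (x\<^sup>2 - 1)"
        using x2_pos by (simp add: pos_le_divide_eq v_def algebra_simps)
      then have "u x / real d \<le> (sqrt (D x) - real n * x) / (x\<^sup>2 - 1) / real d"
        by (rule divide_right_mono) simp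
      then show ?thesis using 3 by (simp add: ct cb)
    qed
  qed
  have "maxroot p = \<rho>" by (simp add: maxroot_def roots \<rho>_def)
  then show ?thesis using max bound by (simp add: p_def)
qed

end
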